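(* For every $\mathbf{cd}$-polynomial $v\in\mathbb{Z}\langle\mathbf{c},\mathbf{d}\rangle$ one has $$T(v\cdot\mathbf{a})=\omega(\mathbf{a}\cdot v^{*})^{*}.$$
   Context: Let $\mathbb{Z}\langle \mathbf{a},\mathbf{b}\rangle$ be the ring of polynomials in noncommuting variables $\mathbf{a},\mathbf{b}$, each of degree $1$. Put $\mathbf{c}=\mathbf{a}+\mathbf{b}$ and $\mathbf{d}=\mathbf{a}\mathbf{b}+\mathbf{b}\mathbf{a}$; $\mathbb{Z}\langle\mathbf{c},\mathbf{d}\rangle$ is the subring of $\mathbb{Z}\langle\mathbf{a},\mathbf{b}\rangle$ generated by $\mathbf{c},\mathbf{d}$, whose elements are called $\mathbf{cd}$-polynomials. The involution $u\mapsto u^*$ is the linear map reversing each $\mathbf{ab}$-monomial. The map $\omega:\mathbb{Z}\langle\mathbf{a},\mathbf{b}\rangle\to\mathbb{Z}\langle\mathbf{c},2\mathbf{d}\rangle\subseteq\mathbb{Z}\langle\mathbf{c},\mathbf{d}\rangle$ is the linear map defined on a monomial in $\mathbf{a},\mathbf{b}$ by replacing each occurrence of $\mathbf{a}\mathbf{b}$ (as two consecutive letters) by $2\mathbf{d}$ and each of the remaining letters by $\mathbf{c}$. Coproduct: for a monomial $u_1\cdots u_n$, $\Delta(u_1\cdots u_n)=\sum_{i=1}^n u_1\cdots u_{i-1}\otimes u_{i+1}\cdots u_n$ (so $\Delta(1)=0$), extended linearly; it is coassociative. $\Delta^1=\mathrm{id}$, $\Delta^{k+1}=(\mathrm{id}\otimes\Delta^k)\circ\Delta$,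 with Sweedler notation $\Delta^k(u)=\sum_u u_{(1)}\otimes\cdots\otimes u_{(k)}$. $A:\mathbb{Z}\langle\mathbf{a},\mathbf{b}\rangle\to\mathbb{Z}$ is the algebra map with $A(\mathbf{a})=1$, $A(\mathbf{b})=0$; $C(u)=2A(u)+\sum_u A(u_{(1)})A(u_{(2)})$. For homogeneous $u$, $\kappa(u)=A(u)(\mathbf{a}-\mathbf{b})^{\deg u}$ and $\nu(u)=C(u)(\mathbf{a}-\mathbf{b})^{\deg u}$, extended linearly. The operator $T$ on $\mathbb{Z}\langle\mathbf{a},\mathbf{b}\rangle$ is $T(u)=\sum_{k\ge1}\sum_u \nu(u_{(1)})\cdot\mathbf{b}\cdot\nu(u_{(2)})\cdot\mathbf{b}\cdots\mathbf{b}\cdot\nu(u_{(k-1)})\cdot\mathbf{b}\cdot\kappa(u_{(k)})$, the coproduct being into $k$ parts. *)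

theory Defs
  imports "HOL-Library.Poly_Mapping"
begin

text \<open>
  Lists form the free monoid under concatenation, so that the convolution product of
  \<^theory>\<open>HOL-Library.Poly_Mapping\<close> turns the finitely supported integer functions on
  lists into a free associative ring.
\<close>

instantiation list :: (type) monoid_add
begin

definition zero_list :: "'a list" where
  "zero_list = []"

definition plus_list :: "'a list \<Rightarrow> 'a list \<Rightarrow> 'a list" where
  "plus_list xs ys = xs @ ys"

instance
  by standard (simp_all add: zero_list_def plus_list_def)

end

datatype letter = La | Lb

type_synonym ab_poly = "letter list \<Rightarrow>\<^sub>0 int"

text \<open>
  The list \<open>[w\<^sub>1, \<dots>, w\<^sub>k]\<close> encodes the basis element
  \<open>w\<^sub>1 \<otimes> \<dots> \<otimes> w\<^sub>k\<close> of the \<open>k\<close>-th tensor power of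
  \<open>\<int>\<langle>a,b\<rangle>\<close>. The ring product of this type, being concatenation of lists, is the
  tensor product (and not the factorwise product of the ring \<open>\<int>\<langle>a,b\<rangle>\<close>).
\<close>

type_synonym ab_tensor = "letter list list \<Rightarrow>\<^sub>0 int"

abbreviation basis :: "'k \<Rightarrow> ('k \<Rightarrow>\<^sub>0 int)" where
  "basis w \<equiv> Poly_Mapping.single w 1"

definition lin :: "('k \<Rightarrow> 'r) \<Rightarrow> ('k \<Rightarrow>\<^sub>0 int) \<Rightarrow> 'r::ring_1" where
  "lin f u = (\<Sum>w\<in>Poly_Mapping.keys u. of_int (Poly_Mapping.lookup u w) * f w)"

definition var_a :: ab_poly where "var_a = basis [La]"
definition var_b :: ab_poly where "var_b = basis [Lb]"
definition var_c :: ab_poly where "var_c = var_a + var_b"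
definition var_d :: ab_poly where "var_d = var_a * var_b + var_b * var_a"

inductive_set cd_polys :: "ab_poly set" where
  one: "1 \<in> cd_polys"
| c: "var_c \<in> cd_polys"
| d: "var_d \<in> cd_polys"
| minus: "u \<in> cd_polys \<Longrightarrow> - u \<in> cd_polys"
| add: "u \<in> cd_polys \<Longrightarrow> v \<in> cd_polys \<Longrightarrow> u + v \<in> cd_polys"
| mult: "u \<in> cd_polys \<Longrightarrow> v \<in> cd_polys \<Longrightarrow> u * v \<in> cd_polys"

definition star :: "ab_poly \<Rightarrow> ab_poly" where
  "star = lin (\<lambda>w. basis (rev w))"

text \<open>Occurrences of \<open>ab\<close> in a word never overlap, so scanning from the left replaces all of them.\<close>

fun omega_word :: "letter list \<Rightarrow> ab_poly" where
  "omega_word [] = 1"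
| "omega_word (La # Lb # w) = 2 * var_d * omega_word w"
| "omega_word (x # w) = var_c * omega_word w"

definition omega :: "ab_poly \<Rightarrow> ab_poly" where
  "omega = lin omega_word"

definition coprod :: "ab_poly \<Rightarrow> ab_tensor" where
  "coprod = lin (\<lambda>w. \<Sum>i<length w. basis [take i w, drop (Suc i) w])"

text \<open>
  The map \<open>id \<otimes> F\<close> on the tensor square of \<open>\<int>\<langle>a,b\<rangle>\<close>;
  basis elements of other tensor powers are sent to the junk value \<open>0\<close>.
\<close>

definition id_tensor :: "(ab_poly \<Rightarrow> ab_tensor) \<Rightarrow> ab_tensor \<Rightarrow> ab_tensor" where
  "id_tensor F = lin (\<lambda>ws. case ws of [x, y] \<Rightarrow> basis [x] * F (basis y) | _ \<Rightarrow> 0)"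

text \<open>
  \<open>coprod_iter k\<close> is \<open>\<Delta>\<^sup>k\<close> for \<open>k \<ge> 1\<close>, the
  coproduct into \<open>k\<close> parts; the value at \<open>k = 0\<close> is junk.
\<close>

fun coprod_iter :: "nat \<Rightarrow> ab_poly \<Rightarrow> ab_tensor" where
  "coprod_iter 0 u = 0"
| "coprod_iter (Suc 0) u = lin (\<lambda>w. basis [w]) u"
| "coprod_iter (Suc (Suc k)) u = id_tensor (coprod_iter (Suc k)) (coprod u)"

definition A :: "ab_poly \<Rightarrow> int" where
  "A = lin (\<lambda>w. \<Prod>x\<leftarrow>w. case x of La \<Rightarrow> 1 | Lb \<Rightarrow> 0)"

definition C :: "ab_poly \<Rightarrow> int" where
  "C u = 2 * A u + lin (\<lambda>ws. \<Prod>w\<leftarrow>ws. A (basis w)) (coprod u)"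

definition kappa :: "ab_poly \<Rightarrow> ab_poly" where
  "kappa = lin (\<lambda>w. of_int (A (basis w)) * (var_a - var_b) ^ length w)"

definition nu :: "ab_poly \<Rightarrow> ab_poly" where
  "nu = lin (\<lambda>w. of_int (C (basis w)) * (var_a - var_b) ^ length w)"

text \<open>\<open>w\<^sub>1 \<otimes> \<dots> \<otimes> w\<^sub>k \<mapsto> \<nu>(w\<^sub>1) b \<nu>(w\<^sub>2) b \<dots> b \<nu>(w\<^bsub>k-1\<^esub>) b \<kappa>(w\<^sub>k)\<close>\<close>

fun T_word :: "letter list list \<Rightarrow> ab_poly" where
  "T_word [] = 0"
| "T_word [w] = kappa (basis w)"
| "T_word (w # w' # ws) = nu (basis w) * var_b * T_word (w' # ws)"

text \<open>
  The sum over all \<open>k \<ge> 1\<close>. \<^const>\<open>Sum_any\<close> is a genuine sum only for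
  finitely many nonzero summands; lemma \<open>finite_T_summands\<close> below shows that this
  is always the case.
\<close>

definition T :: "ab_poly \<Rightarrow> ab_poly" where
  "T u = Sum_any (\<lambda>k. if k \<ge> 1 then lin T_word (coprod_iter k u) else 0)"

lemma keys_sum_singleD:
  assumes "t \<in> Poly_Mapping.keys (sum f I)"
  obtains i where "i \<in> I" "t \<in> Poly_Mapping.keys (f i)"
proof -
  have "(\<Sum>i\<in>I. Poly_Mapping.lookup (f i) t) \<noteq> 0"
    using assms by (simp add: in_keys_iff lookup_sum)
  then obtain i where "i \<in> I" "Poly_Mapping.lookup (f i) t \<noteq> 0"
    by (meson sum.neutral)
  then show thesis
    using that by (simp add: in_keys_iff)
qed

lemma of_int_mult_basis:
  "of_int n * (basis k :: 'k::monoid_add \<Rightarrow>\<^sub>0 int) = Poly_Mapping.single k n"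
proof -
  have "(of_int n :: 'k \<Rightarrow>\<^sub>0 int) = Poly_Mapping.single 0 n"
    by (metis id_apply of_int_eq_id single_of_int)
  then show ?thesis
    by (simp only: mult_single add_0_left mult_1_right)
qed

lemma keys_coprodD:
  assumes "t \<in> Poly_Mapping.keys (coprod u)"
  obtains w i where "w \<in> Poly_Mapping.keys u" "i < length w" "t = [take i w, drop (Suc i) w]"
proof -
  obtain w where w: "w \<in> Poly_Mapping.keys u"
    and t: "t \<in> Poly_Mapping.keys (of_int (Poly_Mapping.lookup u w) *
      (\<Sum>i<length w. (basis [take i w, drop (Suc i) w] :: ab_tensor)))"
    using assms unfolding coprod_def lin_def by (rule keys_sum_singleD)
  have "t \<in> Poly_Mapping.keys (\<Sum>i<length w.
      (Poly_Mapping.single [take i w, drop (Suc i) w] (Poly_Mapping.lookup u w) :: ab_tensor))"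
    using t by (simp add: sum_distrib_left of_int_mult_basis)
  then obtain i where i: "i < length w" "t = [take i w, drop (Suc i) w]"
    by (elim keys_sum_singleD) (auto split: if_splits)
  show thesis
    using w i that by blast
qed

lemma coprod_iter_eq_0:
  assumes "\<And>w. w \<in> Poly_Mapping.keys u \<Longrightarrow> length w < k"
  shows "coprod_iter (Suc k) u = 0"
  using assms
proof (induction k arbitrary: u)
  case 0
  then have "Poly_Mapping.keys u = {}" by blast
  then show ?case by (simp add: lin_def del: keys_eq_empty)
next
  case (Suc k)
  have "(case t of [x, y] \<Rightarrow> basis [x] * coprod_iter (Suc k) (basis y) | _ \<Rightarrow> 0) = 0"
    if "t \<in> Poly_Mapping.keys (coprod u)" for t
  proof -
    obtain w i where w: "w \<in> Poly_Mapping.keys u" and i: "i < length w"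
      and t: "t = [take i w, drop (Suc i) w]"
      using \<open>t \<in> Poly_Mapping.keys (coprod u)\<close> by (rule keys_coprodD)
    have "length w < Suc k" using w by (rule Suc.prems)
    then have "coprod_iter (Suc k) (basis (drop (Suc i) w)) = 0"
      using i by (intro Suc.IH) auto
    then show ?thesis by (simp add: t)
  qed
  then show ?case by (simp add: id_tensor_def lin_def del: coprod_iter.simps(2))
qed

lemma finite_T_summands:
  "finite {k. (if k \<ge> 1 then lin T_word (coprod_iter k u) else 0) \<noteq> 0}"
proof -
  define m where "m = Suc (Max (length ` Poly_Mapping.keys u))"
  have "coprod_iter (Suc k) u = 0" if "k \<ge> m" for k
  proof (rule coprod_iter_eq_0)
    fix w assume "w \<in> Poly_Mapping.keys u"
    then have "length w \<le> Max (length ` Poly_Mapping.keys u)" by simp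
    then show "length w < k" using that by (simp add: m_def)
  qed
  then have "lin T_word (coprod_iter k u) = 0" if "k > m" for k
    using that by (cases k) (auto simp: lin_def)
  then have "{k. (if k \<ge> 1 then lin T_word (coprod_iter k u) else 0) \<noteq> 0} \<subseteq> {..m}"
    by (auto simp: not_less[symmetric] split: if_splits)
  then show ?thesis by (rule finite_subset) simp
qed

end

theory Submission
  imports Defs
begin

text \<open>
  Both sides are computed by automata that read a word letter by letter, with transition weights
  in the ring of noncommutative polynomials; the theorem holds because the two automata are
  intertwined on words in \<open>c\<close> and \<open>d\<close>. Write \<open>e = a - b\<close>.

  The operator \<open>T\<close> sums over all ways to remove letters from a word. A removed letter is replaced
  by \<open>b\<close>, every other letter by \<open>e\<close>, and each maximal block of letters between removed ones is
  weighted by \<open>C\<close>, the last block by \<open>A\<close>. Both weights are recognised by a device with two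
  states, so \<open>T(w)\<close> is the upper left entry of a product \<open>M(w)\<close> of two-by-two matrices, one for
  each letter (\<open>T_basis\<close>):
  \<open>M(a) = ((c, e), (b, e))\<close> and \<open>M(b) = ((2b, e), (b, 0))\<close>.

  After the two reversals, the right-hand side replaces each \<open>ba\<close> in the word \<open>va\<close> by \<open>2d\<close> and
  each remaining letter by \<open>c\<close>. For a prefix \<open>w\<close> of \<open>v\<close>, keeping track of the values obtained
  from \<open>w a\<close> and from \<open>w\<close> together gives matrices \<open>N(a) = ((c, 2), (0, 0))\<close> and \<open>N(b) = ((0, 0), (d, c))\<close>, and the
  result is the upper left entry of \<open>P N(v)\<close> with \<open>P = ((c, 2), (b, 1))\<close> (\<open>star_omega_lin\<close>).

  The maps \<open>M\<close> and \<open>N\<close> extend to ring homomorphisms on polynomials. In general \<open>M(v) P\<close>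
  and \<open>P N(v)\<close> differ, but they agree for \<open>v = c\<close> and \<open>v = d\<close>, and therefore on the subring
  generated by \<open>c\<close> and \<open>d\<close> (\<open>intertwining\<close>). As \<open>M(a)\<close> and \<open>P\<close> have the same first column,
  \<open>T(v a) = (M(v) M(a))\<^sub>1\<^sub>1 = (M(v) P)\<^sub>1\<^sub>1 = (P N(v))\<^sub>1\<^sub>1\<close>.
\<close>


section \<open>Linear extension\<close>

lemma lin_0 [simp]: "lin f 0 = 0"
  by (simp add: lin_def)

lemma lin_superset:
  assumes "finite S" "Poly_Mapping.keys u \<subseteq> S"
  shows "lin f u = (\<Sum>w\<in>S. of_int (Poly_Mapping.lookup u w) * f w)"
  unfolding lin_def using assms by (intro sum.mono_neutral_left) (auto simp: in_keys_iff)

lemma lin_add: "lin f (u + v) = lin f u + lin f v"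
proof -
  define S where "S = Poly_Mapping.keys u \<union> Poly_Mapping.keys v"
  have "finite S" "Poly_Mapping.keys u \<subseteq> S" "Poly_Mapping.keys v \<subseteq> S"
    "Poly_Mapping.keys (u + v) \<subseteq> S"
    using Poly_Mapping.keys_add[of u v] by (auto simp: S_def)
  then show ?thesis
    by (simp add: lin_superset lookup_add distrib_right sum.distrib)
qed

lemma lin_uminus: "lin f (- u) = - lin f u"
  using lin_add[of f u "- u"] by (simp add: add_eq_0_iff)

lemma lin_diff: "lin f (u - v) = lin f u - lin f v"
  using lin_add[of f "u - v" v] by simp

lemma lin_sum: "lin f (sum g I) = (\<Sum>i\<in>I. lin f (g i))"
  by (induction I rule: infinite_finite_induct) (simp_all add: lin_add)

lemma lin_basis [simp]: "lin f (basis w) = f w"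
  by (simp add: lin_def)

lemma lin_cong:
  assumes "\<And>w. w \<in> Poly_Mapping.keys u \<Longrightarrow> f w = g w"
  shows "lin f u = lin g u"
  unfolding lin_def using assms by (intro sum.cong) simp_all

lemma basis_induct [case_names basis diff]:
  fixes u :: "'k \<Rightarrow>\<^sub>0 int"
  assumes basis: "\<And>w. P (basis w)"
    and diff: "\<And>u v. P u \<Longrightarrow> P v \<Longrightarrow> P (u - v)"
  shows "P u"
proof (rule frag_induction[of u UNIV])
  show "P 0"
    using diff[OF basis basis] by (metis diff_self)
qed (use assms in simp_all)

lemma additive_lin:
  assumes add: "\<And>x y. h (x + y) = h x + h y"
  shows "h (lin f u) = lin (\<lambda>w. h (f w)) u"
proof -
  have "h (x - y) = h x - h y" for x y
    using add[of "x - y" y] by simp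
  then show ?thesis
    by (induction u rule: basis_induct) (simp_all add: lin_diff)
qed

text \<open>
  The product of polynomials is the convolution over the monoid of words, so a monoid homomorphism
  on words extends to a ring homomorphism. This is how word-by-word products of matrices become
  multiplicative in the polynomial.
\<close>

lemma lin_mult:
  assumes hom: "\<And>x y. f (x + y) = f x * f y"
  shows "lin f (u * v) = lin f u * lin f v"
proof (induction u rule: basis_induct)
  case (basis x)
  show ?case
    by (induction v rule: basis_induct)
      (simp_all add: mult_single hom lin_diff right_diff_distrib)
qed (simp add: lin_diff left_diff_distrib)

lemma basis_Nil: "(basis [] :: 'a list \<Rightarrow>\<^sub>0 int) = 1"
  by (metis single_one zero_list_def)

lemma basis_mult_basis: "(basis x :: 'a list \<Rightarrow>\<^sub>0 int) * basis y = basis (x @ y)"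
  by (simp add: mult_single plus_list_def)


section \<open>Two-by-two matrices over a noncommutative ring\<close>

text \<open>
  The operator \<^const>\<open>lin\<close> takes values in a type of class \<^class>\<open>ring_1\<close>. Matrices form a type
  of this class here, so that extending a matrix-valued map linearly needs nothing new.
\<close>

datatype 'a mat2 = Mat2 (m11: 'a) (m12: 'a) (m21: 'a) (m22: 'a)

instantiation mat2 :: (ring_1) ring_1
begin

definition zero_mat2 :: "'a mat2" where
  "zero_mat2 = Mat2 0 0 0 0"

definition one_mat2 :: "'a mat2" where
  "one_mat2 = Mat2 1 0 0 1"

definition plus_mat2 :: "'a mat2 \<Rightarrow> 'a mat2 \<Rightarrow> 'a mat2" where
  "plus_mat2 X Y = Mat2 (m11 X + m11 Y) (m12 X + m12 Y) (m21 X + m21 Y) (m22 X + m22 Y)"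

definition uminus_mat2 :: "'a mat2 \<Rightarrow> 'a mat2" where
  "uminus_mat2 X = Mat2 (- m11 X) (- m12 X) (- m21 X) (- m22 X)"

definition minus_mat2 :: "'a mat2 \<Rightarrow> 'a mat2 \<Rightarrow> 'a mat2" where
  "minus_mat2 X Y = Mat2 (m11 X - m11 Y) (m12 X - m12 Y) (m21 X - m21 Y) (m22 X - m22 Y)"

definition times_mat2 :: "'a mat2 \<Rightarrow> 'a mat2 \<Rightarrow> 'a mat2" where
  "times_mat2 X Y = Mat2
     (m11 X * m11 Y + m12 X * m21 Y) (m11 X * m12 Y + m12 X * m22 Y)
     (m21 X * m11 Y + m22 X * m21 Y) (m21 X * m12 Y + m22 X * m22 Y)"

instance
  by standard
    (simp_all add: zero_mat2_def one_mat2_def plus_mat2_def uminus_mat2_def minus_mat2_def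
      times_mat2_def algebra_simps)

end

definition word_mat :: "(letter \<Rightarrow> ab_poly mat2) \<Rightarrow> letter list \<Rightarrow> ab_poly mat2" where
  "word_mat f w = (\<Prod>x\<leftarrow>w. f x)"

lemma word_mat_simps [simp]:
  "word_mat f [] = 1"
  "word_mat f (x # w) = f x * word_mat f w"
  "word_mat f (v @ w) = word_mat f v * word_mat f w"
  by (simp_all add: word_mat_def)

lemma lin_word_mat_mult:
  "lin (word_mat f) (u * v) = lin (word_mat f) u * lin (word_mat f) v"
  by (rule lin_mult) (simp add: plus_list_def)

lemma m11_lin: "m11 (lin F u) = lin (\<lambda>w. m11 (F w)) u"
  by (rule additive_lin) (simp add: plus_mat2_def)


section \<open>The operator T as an automaton\<close>

text \<open>
  The two states describe the current block of letters between removed ones. In the first state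
  the block consists of \<open>a\<close> only. In the second one, one letter of the block has been singled out
  as the letter that the coproduct inside \<^const>\<open>C\<close> deletes, and all others must be \<open>a\<close>.
  A row is the state before a letter and a column the state after it. Keeping the letter
  contributes \<open>a - b\<close>. Removing it contributes \<open>b\<close>, closes the block and returns to the first
  state; the coefficient \<open>2\<close> in the first state is the one in the definition of \<^const>\<open>C\<close>.
  The upper left entry for \<open>a\<close> is \<open>(a - b) + 2 b = c\<close>.
\<close>

fun T_mat :: "letter \<Rightarrow> ab_poly mat2" where
  "T_mat La = Mat2 var_c (var_a - var_b) var_b (var_a - var_b)"
| "T_mat Lb = Mat2 (2 * var_b) (var_a - var_b) var_b 0"

lemma coprod_iter_lin:
  "coprod_iter (Suc k) u = lin (\<lambda>w. coprod_iter (Suc k) (basis w)) u"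
  by (cases k)
    (simp_all add: id_tensor_def coprod_def additive_lin[where h = "lin _", OF lin_add])

lemma coprod_iter_basis:
  "coprod_iter (Suc (Suc k)) (basis w) =
     (\<Sum>i<length w. basis [take i w] * coprod_iter (Suc k) (basis (drop (Suc i) w)))"
  by (simp add: id_tensor_def coprod_def lin_sum)

text \<open>
  A basis tensor with no factor must be excluded because \<^const>\<open>T_word\<close> sends it to \<open>0\<close>, and
  prefixing a factor \<open>x\<close> would then give \<open>kappa x\<close> and not a multiple of \<open>nu x\<close>.
\<close>

lemma keys_coprod_iter:
  "[] \<notin> Poly_Mapping.keys (coprod_iter (Suc k) (basis w))"
proof (cases k)
  case (Suc k')
  show ?thesis
  proof
    assume "[] \<in> Poly_Mapping.keys (coprod_iter (Suc k) (basis w))"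
    then obtain i where "[] \<in> Poly_Mapping.keys
      (basis [take i w] * coprod_iter (Suc k') (basis (drop (Suc i) w)))"
      unfolding Suc coprod_iter_basis by (rule keys_sum_singleD)
    then have "[] \<in> {x + y |x y. x \<in> {[take i w]} \<and>
       y \<in> Poly_Mapping.keys (coprod_iter (Suc k') (basis (drop (Suc i) w)))}"
      using keys_mult by fastforce
    then show False by (auto simp: plus_list_def)
  qed
qed simp

text \<open>The contribution to \<open>T\<close> of the splittings into \<open>k + 1\<close> blocks, so with \<open>k\<close> removed letters.\<close>

definition T_part :: "nat \<Rightarrow> letter list \<Rightarrow> ab_poly" where
  "T_part k w = lin T_word (coprod_iter (Suc k) (basis w))"

lemma T_part_0: "T_part 0 w = kappa (basis w)"
  by (simp add: T_part_def)

lemma T_part_Suc: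
  "T_part (Suc k) w =
     (\<Sum>i<length w. nu (basis (take i w)) * var_b * T_part k (drop (Suc i) w))"
proof -
  have *: "lin T_word (basis [x] * z) = nu (basis x) * var_b * lin T_word z"
    if "[] \<notin> Poly_Mapping.keys z" for x z
  proof -
    have "basis [x] * z = lin (\<lambda>ws. basis (x # ws)) z"
      by (induction z rule: basis_induct)
        (simp_all add: basis_mult_basis lin_diff right_diff_distrib)
    then have "lin T_word (basis [x] * z) = lin (\<lambda>ws. T_word (x # ws)) z"
      by (simp add: additive_lin[where h = "lin _", OF lin_add])
    also have "\<dots> = lin (\<lambda>ws. nu (basis x) * var_b * T_word ws) z"
    proof (rule lin_cong)
      fix ws assume "ws \<in> Poly_Mapping.keys z"
      then show "T_word (x # ws) = nu (basis x) * var_b * T_word ws"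
        using that by (cases ws) auto
    qed
    also have "\<dots> = nu (basis x) * var_b * lin T_word z"
      by (rule additive_lin[symmetric]) (simp add: distrib_left)
    finally show ?thesis .
  qed
  show ?thesis
    unfolding T_part_def coprod_iter_basis lin_sum by (simp only: *[OF keys_coprod_iter])
qed

text \<open>
  A word of length less than \<open>n\<close> cannot lose \<open>n\<close> letters. Bounding the number of blocks
  uniformly for all words of a polynomial is what makes \<open>T\<close> visibly linear.
\<close>

lemma T_truncate:
  assumes "\<And>w. w \<in> Poly_Mapping.keys u \<Longrightarrow> length w < n"
  shows "T u = (\<Sum>k<n. lin T_word (coprod_iter (Suc k) u))"
proof -
  have "T u = (\<Sum>k\<in>Suc ` {..<n}. if k \<ge> 1 then lin T_word (coprod_iter k u) else 0)"
    unfolding T_def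
  proof (rule Sum_any.expand_superset)
    show "{k. (if k \<ge> 1 then lin T_word (coprod_iter k u) else 0) \<noteq> 0} \<subseteq> Suc ` {..<n}"
    proof
      fix k assume "k \<in> {k. (if k \<ge> 1 then lin T_word (coprod_iter k u) else 0) \<noteq> 0}"
      then have k: "k \<ge> 1" "coprod_iter k u \<noteq> 0" by (auto split: if_splits)
      then obtain j where j: "k = Suc j" by (cases k) auto
      have "j < n"
      proof (rule ccontr)
        assume "\<not> j < n"
        then have "coprod_iter (Suc j) u = 0"
          using assms by (intro coprod_iter_eq_0) (meson less_le_trans not_less)
        then show False using k j by simp
      qed
      then show "k \<in> Suc ` {..<n}" by (simp add: j)
    qed
  qed simp
  also have "\<dots> = (\<Sum>k<n. lin T_word (coprod_iter (Suc k) u))"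
    by (simp add: sum.reindex)
  finally show ?thesis .
qed

lemma T_basis_truncate: "length w < n \<Longrightarrow> T (basis w) = (\<Sum>k<n. T_part k w)"
  unfolding T_part_def by (rule T_truncate) simp

text \<open>
  Split a summand with at least two blocks at the first removed letter: the block before it is
  weighted by \<^const>\<open>nu\<close>, and the remaining blocks run through all summands of \<open>T\<close> on the tail.
\<close>

lemma T_basis_rec:
  "T (basis w) = kappa (basis w) +
     (\<Sum>i<length w. nu (basis (take i w)) * var_b * T (basis (drop (Suc i) w)))"
proof -
  have "T (basis w) = (\<Sum>k<Suc (length w). T_part k w)"
    by (rule T_basis_truncate) simp
  also have "\<dots> = kappa (basis w) + (\<Sum>i<length w. \<Sum>k<length w.
      nu (basis (take i w)) * var_b * T_part k (drop (Suc i) w))"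
    by (subst sum.lessThan_Suc_shift, subst sum.swap) (simp add: T_part_0 T_part_Suc)
  also have "(\<Sum>i<length w. \<Sum>k<length w.
      nu (basis (take i w)) * var_b * T_part k (drop (Suc i) w)) =
      (\<Sum>i<length w. nu (basis (take i w)) * var_b * T (basis (drop (Suc i) w)))"
    by (intro sum.cong) (auto simp: sum_distrib_left T_basis_truncate[of _ "length w"])
  finally show ?thesis .
qed

lemma T_lin: "T u = lin (\<lambda>w. T (basis w)) u"
proof -
  obtain n where n: "\<And>w. w \<in> Poly_Mapping.keys u \<Longrightarrow> length w < n"
  proof
    fix w assume "w \<in> Poly_Mapping.keys u"
    then show "length w < Suc (Max (length ` Poly_Mapping.keys u))"
      by (simp add: less_Suc_eq_le)
  qed
  have "T u = (\<Sum>k<n. lin T_word (coprod_iter (Suc k) u))"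
    using n by (rule T_truncate)
  also have "\<dots> = (\<Sum>k<n. lin (T_part k) u)"
    unfolding T_part_def
    by (subst coprod_iter_lin) (simp only: additive_lin[where h = "lin _", OF lin_add])
  also have "\<dots> = lin (\<lambda>w. \<Sum>k<n. T_part k w) u"
    by (simp add: lin_def sum_distrib_left) (rule sum.swap)
  also have "\<dots> = lin (\<lambda>w. T (basis w)) u"
    using n by (intro lin_cong T_basis_truncate[symmetric])
  finally show ?thesis .
qed

lemma A_simps [simp]:
  "A (basis []) = 1"
  "A (basis (La # w)) = A (basis w)"
  "A (basis (Lb # w)) = 0"
  by (simp_all add: A_def)

lemma C_Nil: "C (basis []) = 2"
  by (simp add: C_def coprod_def)

lemma C_basis:
  "C (basis w) = 2 * A (basis w) +
     (\<Sum>i<length w. A (basis (take i w)) * A (basis (drop (Suc i) w)))"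
  by (simp add: C_def coprod_def lin_sum)

text \<open>
  The coproduct term of \<open>x w\<close> in which the first letter is deleted contributes \<open>A(w)\<close> whatever
  \<open>x\<close> is. All other terms of \<open>C(x w)\<close> keep \<open>x\<close>, so they vanish for \<open>x = b\<close> and add up to
  \<open>C(w)\<close> for \<open>x = a\<close>.
\<close>

lemma C_Cons:
  "C (basis (La # w)) = C (basis w) + A (basis w)"
  "C (basis (Lb # w)) = A (basis w)"
  by (simp_all add: C_basis sum.lessThan_Suc_shift del: sum.lessThan_Suc)

text \<open>
  The sum over the position of the first removed letter, where \<open>T\<close> is applied to the tail after
  it and the block before it has weight \<open>g\<close>. The recursion for \<open>T\<close> has
  the weight \<open>C\<close>; computing \<open>C\<close> letter by letter makes the weight \<open>A\<close> appear as well.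
\<close>

definition block_sum :: "(letter list \<Rightarrow> int) \<Rightarrow> letter list \<Rightarrow> ab_poly" where
  "block_sum g w = (\<Sum>i<length w. of_int (g (take i w)) *
     ((var_a - var_b) ^ i * (var_b * T (basis (drop (Suc i) w)))))"

lemma of_int_left_commute: "of_int n * (y * z) = y * (of_int n * z)"
  for y z :: "'r::ring_1"
  by (metis mult.assoc mult_of_int_commute)

lemma block_sum_Nil: "block_sum g [] = 0"
  by (simp add: block_sum_def)

lemma block_sum_Cons:
  "block_sum g (x # w) =
     of_int (g []) * (var_b * T (basis w)) + (var_a - var_b) * block_sum (\<lambda>v. g (x # v)) w"
  by (simp add: block_sum_def sum.lessThan_Suc_shift sum_distrib_left mult.assoc
      of_int_left_commute del: sum.lessThan_Suc)

lemma block_sum_add: "block_sum (\<lambda>v. g v + h v) w = block_sum g w + block_sum h w"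
  by (simp add: block_sum_def distrib_right sum.distrib)

lemma block_sum_0: "block_sum (\<lambda>v. 0) w = 0"
  by (simp add: block_sum_def)

lemma T_basis_block_sum:
  "T (basis w) = of_int (A (basis w)) * (var_a - var_b) ^ length w + block_sum (\<lambda>v. C (basis v)) w"
  by (subst T_basis_rec) (simp add: kappa_def nu_def block_sum_def mult.assoc)

text \<open>
  By the two rules for \<^const>\<open>C\<close>, peeling off the first letter expresses \<open>T(x w)\<close> through \<open>T(w)\<close>
  and the block sum \<open>V(w)\<close> with weight \<open>A\<close>, and likewise for \<open>V(x w)\<close>. So the column
  \<open>(T(w), V(w))\<close> satisfies the recursion of the first column of the matrix product.
\<close>

lemma T_basis: "T (basis w) = m11 (word_mat T_mat w)"
proof -
  define V where "V = block_sum (\<lambda>v. A (basis v))"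
  have V_Nil: "V [] = 0"
    by (simp add: V_def block_sum_Nil)
  have V_La: "V (La # w) = var_b * T (basis w) + (var_a - var_b) * V w" for w
    by (simp add: V_def block_sum_Cons)
  have V_Lb: "V (Lb # w) = var_b * T (basis w)" for w
    by (simp add: V_def block_sum_Cons block_sum_0)
  have T_Nil: "T (basis []) = 1"
    by (subst T_basis_block_sum) (simp add: block_sum_Nil)
  have T_La: "T (basis (La # w)) = var_c * T (basis w) + (var_a - var_b) * V w" for w
  proof -
    have "T (basis (La # w)) = (var_a - var_b) * T (basis w) + 2 * (var_b * T (basis w))
        + (var_a - var_b) * V w"
      unfolding T_basis_block_sum[of "La # w"] block_sum_Cons C_Nil C_Cons block_sum_add
        V_def[symmetric]
      by (subst (2) T_basis_block_sum) (simp add: of_int_left_commute distrib_left add_ac)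
    then show ?thesis
      by (simp add: var_c_def algebra_simps mult_2)
  qed
  have T_Lb: "T (basis (Lb # w)) = 2 * var_b * T (basis w) + (var_a - var_b) * V w" for w
    unfolding T_basis_block_sum[of "Lb # w"] block_sum_Cons C_Nil C_Cons V_def
    by (simp add: mult.assoc)
  have "T (basis w) = m11 (word_mat T_mat w) \<and> V w = m21 (word_mat T_mat w)"
  proof (induction w)
    case Nil
    then show ?case by (simp add: V_Nil T_Nil one_mat2_def)
  next
    case (Cons x w)
    then show ?case
      by (cases x) (simp_all add: V_La V_Lb T_La T_Lb times_mat2_def)
  qed
  then show ?thesis ..
qed


section \<open>Reversed omega as an automaton\<close>

text \<open>
  Reading \<open>w\<close> from left to right maintains the row \<open>(F, 2 H)\<close>, where \<open>F\<close> and \<open>H\<close> are the values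
  obtained from \<open>w a\<close> and from \<open>w\<close> when each \<open>ba\<close> is replaced by \<open>2d\<close> and each other letter by
  \<open>c\<close>. Appending \<open>a\<close> turns \<open>(F, H)\<close> into \<open>(F c, F)\<close>; appending \<open>b\<close> turns it into
  \<open>(2 H d, H c)\<close>. The factor \<open>2\<close> in front of \<open>H\<close> keeps the matrix \<open>intertwiner\<close> integral.
\<close>

fun omega_mat :: "letter \<Rightarrow> ab_poly mat2" where
  "omega_mat La = Mat2 var_c 2 0 0"
| "omega_mat Lb = Mat2 0 0 var_d var_c"

text \<open>
  The first row is the initial row \<open>(F, 2 H)\<close> of the empty word, and the first column is that of
  the matrix \<^term>\<open>T_mat La\<close>. The last entry comes from comparing the two sides on \<open>v c\<close>: if
  \<open>(x, y)\<close> is the first row of the matrix product for \<open>T\<close>, then \<open>F = x c + y b\<close> forces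
  \<open>2 H = 2 x + y\<close>, because \<open>b c + (a - b) b = d\<close>.
\<close>

definition intertwiner :: "ab_poly mat2" where
  "intertwiner = Mat2 var_c 2 var_b 1"

lemma star_add: "star (u + v) = star u + star v"
  by (simp add: star_def lin_add)

lemma star_diff: "star (u - v) = star u - star v"
  by (simp add: star_def lin_diff)

lemma star_basis: "star (basis w) = basis (rev w)"
  by (simp add: star_def)

lemma star_mult: "star (u * v) = star v * star u"
proof (induction u rule: basis_induct)
  case (basis x)
  show ?case
    by (induction v rule: basis_induct)
      (simp_all add: basis_mult_basis star_basis star_diff right_diff_distrib left_diff_distrib)
qed (simp add: star_diff right_diff_distrib left_diff_distrib)

lemma star_1: "star 1 = 1"
  using star_basis[of "[]"] by (simp add: basis_Nil)

lemma star_var [simp]: "star var_c = var_c" "star var_d = var_d"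
  by (simp_all add: var_c_def var_d_def star_add star_mult var_a_def var_b_def star_basis)

lemma star_omega_word:
  "star (omega_word (La # rev w)) = m11 (intertwiner * word_mat omega_mat w) \<and>
   2 * star (omega_word (rev w)) = m12 (intertwiner * word_mat omega_mat w)"
proof (induction w rule: rev_induct)
  case Nil
  show ?case by (simp add: intertwiner_def star_1)
next
  case (snoc x w)
  define X where "X = intertwiner * word_mat omega_mat w"
  have X: "intertwiner * word_mat omega_mat (w @ [x]) = X * omega_mat x"
    by (simp add: X_def mult.assoc)
  have IH: "m11 X = star (omega_word (La # rev w))" "m12 X = 2 * star (omega_word (rev w))"
    using snoc by (simp_all add: X_def)
  show ?case
    unfolding X
    by (cases x)
      (simp_all add: times_mat2_def IH star_mult star_add mult_2 mult_2_right
        distrib_left distrib_right)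
qed

lemma star_omega_lin:
  "star (omega (var_a * star v)) = m11 (intertwiner * lin (word_mat omega_mat) v)"
proof -
  have "star (omega (var_a * star v)) = lin (\<lambda>w. star (omega_word (La # rev w))) v"
    by (induction v rule: basis_induct)
      (simp_all add: star_basis var_a_def basis_mult_basis omega_def star_diff
        lin_diff right_diff_distrib)
  also have "\<dots> = m11 (lin (\<lambda>w. intertwiner * word_mat omega_mat w) v)"
    by (simp add: star_omega_word m11_lin)
  also have "lin (\<lambda>w. intertwiner * word_mat omega_mat w) v =
      intertwiner * lin (word_mat omega_mat) v"
    by (rule additive_lin[symmetric]) (simp add: distrib_left)
  finally show ?thesis .
qed


section \<open>The two automata on cd-polynomials\<close>

lemma lin_word_mat_simps:
  "lin (word_mat f) 1 = 1"
  "lin (word_mat f) var_a = f La"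
  "lin (word_mat f) var_b = f Lb"
  by (simp_all add: var_a_def var_b_def flip: basis_Nil)

text \<open>
  The relation passes to sums and products, so it is enough to check it for \<open>c\<close> and \<open>d\<close>. It fails
  for the single letters \<open>a\<close> and \<open>b\<close>: the contribution of \<open>a\<close> and that of \<open>b\<close> must be added first.
\<close>

lemma intertwining:
  assumes "v \<in> cd_polys"
  shows "lin (word_mat T_mat) v * intertwiner = intertwiner * lin (word_mat omega_mat) v"
  using assms
proof induction
  case one
  then show ?case by (simp add: lin_word_mat_simps)
next
  case c
  then show ?case
    unfolding var_c_def lin_add lin_word_mat_simps
    by (simp add: intertwiner_def plus_mat2_def times_mat2_def var_c_def var_d_def
        algebra_simps mult_2 mult_2_right)
next
  case d
  then show ?case
    unfolding var_d_def lin_add lin_word_mat_mult lin_word_mat_simps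
    by (simp add: intertwiner_def plus_mat2_def times_mat2_def var_c_def var_d_def
        algebra_simps mult_2 mult_2_right)
next
  case (minus u)
  then show ?case by (simp add: lin_uminus)
next
  case (add u v)
  then show ?case by (simp add: lin_add distrib_left distrib_right)
next
  case (mult u v)
  have "lin (word_mat T_mat) (u * v) * intertwiner =
      lin (word_mat T_mat) u * (intertwiner * lin (word_mat omega_mat) v)"
    by (simp add: lin_word_mat_mult mult.assoc mult.IH)
  also have "\<dots> = intertwiner * lin (word_mat omega_mat) (u * v)"
    by (simp add: lin_word_mat_mult mult.IH flip: mult.assoc)
  finally show ?case .
qed

theorem theorem6p2:
  fixes v :: ab_poly
  assumes "v \<in> cd_polys"
  shows "T (v * var_a) = star (omega (var_a * star v))"
proof -
  have "T (v * var_a) = m11 (lin (word_mat T_mat) (v * var_a))"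
    by (subst T_lin) (simp add: T_basis m11_lin)
  also have "\<dots> = m11 (lin (word_mat T_mat) v * T_mat La)"
    by (simp add: lin_word_mat_mult lin_word_mat_simps)
  also have "\<dots> = m11 (lin (word_mat T_mat) v * intertwiner)"
    by (simp add: times_mat2_def intertwiner_def)
  also have "\<dots> = star (omega (var_a * star v))"
    by (simp add: intertwining[OF assms] star_omega_lin)
  finally show ?thesis .
qed

end
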